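(* Let $\mathcal{H}$ be a right quaternionic Hilbert space, let $T\in\mathcal{B}(\mathcal{H})$ be self-adjoint and let $\varepsilon>0$. Then $$\Lambda_\varepsilon^S(T)=\bigcup_{\lambda\in\sigma_S(T)}\Omega_{D(\lambda,\sqrt{\varepsilon})},$$ where $D(\lambda,r)=\{z\in\mathbb{C}:|z-\lambda|\le r\}$ is the closed disc in the complex plane. (For self-adjoint $T$ one has $\sigma_S(T)\subset\mathbb{R}$.)
   Context: $\mathbb{H}$ is the division ring of real quaternions, with $\mathbb{C}=\mathbb{R}+\mathbb{R}i\subset\mathbb{H}$; $\mathrm{Re}(q)$ and $|q|$ denote the real part and modulus of $q\in\mathbb{H}$. $\mathbb{S}=\{m\in\mathbb{H}: m^2=-1\}$ is the sphere of imaginary units. For $X\subseteq\mathbb{C}$ nonempty, its circularization is $\Omega_X=\{\alpha+\beta m:\ \alpha,\beta\in\mathbb{R},\ \alpha+\beta i\in X,\ m\in\mathbb{S}\}$. A right quaternionic Hilbert space is a right $\mathbb{H}$-module with an $\mathbb{H}$-valued inner product (positive definite, right $\mathbb{H}$-linear in the second variable, $\langle x,y\rangle=\overline{\langle y,x\rangle}$), complete in the induced norm. $\mathcal{B}(\mathcal{H})$ is the real Banach algebra of bounded right $\mathbb{H}$-linear operators on $\mathcal{H}$ with the operator norm; $T$ is self-adjoint if $T^*=T$. For $T\in\mathcal{B}(\mathcal{H})$ and $q\in\mathbb{H}$ put $Q_q(T)=T^2-2\,\mathrm{Re}(q)T+|q|^2I$. The $S$-spectrum is $\sigma_S(T)=\{q\in\mathbb{H}: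 Q_q(T)\text{ is not invertible in }\mathcal{B}(\mathcal{H})\}$. For $\varepsilon>0$ the pseudo $S$-spectrum is $\Lambda_\varepsilon^S(T)=\sigma_S(T)\cup\{q\in\mathbb{H}\setminus\sigma_S(T): \|Q_q(T)^{-1}\|\ge 1/\varepsilon\}$. *)

theory Defs
  imports "HOL-Analysis.Analysis"
begin

section \<open>The division ring of real quaternions\<close>

datatype quat = Quat (qre: real) (qim1: real) (qim2: real) (qim3: real)

lemma quat_eq_iff:
  "p = q \<longleftrightarrow> qre p = qre q \<and> qim1 p = qim1 q \<and> qim2 p = qim2 q \<and> qim3 p = qim3 q"
  by (auto intro: quat.expand)

instantiation quat :: ring_1
begin

definition zero_quat :: quat where "0 = Quat 0 0 0 0"
definition one_quat :: quat where "1 = Quat 1 0 0 0"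

definition plus_quat :: "quat \<Rightarrow> quat \<Rightarrow> quat" where
  "p + q = Quat (qre p + qre q) (qim1 p + qim1 q) (qim2 p + qim2 q) (qim3 p + qim3 q)"

definition uminus_quat :: "quat \<Rightarrow> quat" where
  "- p = Quat (- qre p) (- qim1 p) (- qim2 p) (- qim3 p)"

definition minus_quat :: "quat \<Rightarrow> quat \<Rightarrow> quat" where
  "p - q = Quat (qre p - qre q) (qim1 p - qim1 q) (qim2 p - qim2 q) (qim3 p - qim3 q)"

definition times_quat :: "quat \<Rightarrow> quat \<Rightarrow> quat" where
  "p * q = Quat
     (qre p * qre q - qim1 p * qim1 q - qim2 p * qim2 q - qim3 p * qim3 q)
     (qre p * qim1 q + qim1 p * qre q + qim2 p * qim3 q - qim3 p * qim2 q)
     (qre p * qim2 q - qim1 p * qim3 q + qim2 p * qre q + qim3 p * qim1 q)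
     (qre p * qim3 q + qim1 p * qim2 q - qim2 p * qim1 q + qim3 p * qre q)"

instance
  by standard
    (simp_all add: quat_eq_iff zero_quat_def one_quat_def plus_quat_def uminus_quat_def
       minus_quat_def times_quat_def algebra_simps)

end

lemma quat_arith_sel [simp]:
  "qre 0 = 0" "qim1 0 = 0" "qim2 0 = 0" "qim3 0 = 0"
  "qre 1 = 1" "qim1 1 = 0" "qim2 1 = 0" "qim3 1 = 0"
  "qre (p + q) = qre p + qre q" "qim1 (p + q) = qim1 p + qim1 q"
  "qim2 (p + q) = qim2 p + qim2 q" "qim3 (p + q) = qim3 p + qim3 q"
  "qre (- p) = - qre p" "qim1 (- p) = - qim1 p"
  "qim2 (- p) = - qim2 p" "qim3 (- p) = - qim3 p"
  "qre (p - q) = qre p - qre q" "qim1 (p - q) = qim1 p - qim1 q"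
  "qim2 (p - q) = qim2 p - qim2 q" "qim3 (p - q) = qim3 p - qim3 q"
  by (simp_all add: zero_quat_def one_quat_def plus_quat_def uminus_quat_def minus_quat_def)

lemma quat_mult_sel [simp]:
  "qre (p * q) = qre p * qre q - qim1 p * qim1 q - qim2 p * qim2 q - qim3 p * qim3 q"
  "qim1 (p * q) = qre p * qim1 q + qim1 p * qre q + qim2 p * qim3 q - qim3 p * qim2 q"
  "qim2 (p * q) = qre p * qim2 q - qim1 p * qim3 q + qim2 p * qre q + qim3 p * qim1 q"
  "qim3 (p * q) = qre p * qim3 q + qim1 p * qim2 q - qim2 p * qim1 q + qim3 p * qre q"
  by (simp_all add: times_quat_def)

instantiation quat :: real_algebra_1
begin

definition scaleR_quat :: "real \<Rightarrow> quat \<Rightarrow> quat" where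
  "scaleR r q = Quat (r * qre q) (r * qim1 q) (r * qim2 q) (r * qim3 q)"

instance
  by standard (simp_all add: quat_eq_iff scaleR_quat_def algebra_simps)

end

lemma quat_scaleR_sel [simp]:
  "qre (scaleR r q) = r * qre q" "qim1 (scaleR r q) = r * qim1 q"
  "qim2 (scaleR r q) = r * qim2 q" "qim3 (scaleR r q) = r * qim3 q"
  by (simp_all add: scaleR_quat_def)

instantiation quat :: real_inner
begin

definition inner_quat :: "quat \<Rightarrow> quat \<Rightarrow> real" where
  "inner p q = qre p * qre q + qim1 p * qim1 q + qim2 p * qim2 q + qim3 p * qim3 q"

definition norm_quat :: "quat \<Rightarrow> real" where
  "norm q = sqrt (inner q q)" for q :: quat

definition sgn_quat :: "quat \<Rightarrow> quat" where
  "sgn q = scaleR (inverse (norm q)) q" for q :: quat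

definition dist_quat :: "quat \<Rightarrow> quat \<Rightarrow> real" where
  "dist p q = norm (p - q)" for p q :: quat

definition uniformity_quat :: "(quat \<times> quat) filter" where
  "uniformity_quat = (INF e\<in>{0 <..}. principal {(p, q). dist p q < e})"

definition open_quat :: "quat set \<Rightarrow> bool" where
  "open_quat U = (\<forall>p\<in>U. eventually (\<lambda>(p', q). p' = p \<longrightarrow> q \<in> U) uniformity)"

instance
proof
  fix p q r :: quat and a :: real
  show "0 \<le> inner p p" by (simp add: inner_quat_def)
  show "(inner p p = 0) = (p = 0)"
    by (simp add: inner_quat_def quat_eq_iff add_nonneg_eq_0_iff)
qed (simp_all add: inner_quat_def norm_quat_def sgn_quat_def dist_quat_def
       uniformity_quat_def open_quat_def algebra_simps)

end

definition qcnj :: "quat \<Rightarrow> quat" where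
  "qcnj q = Quat (qre q) (- qim1 q) (- qim2 q) (- qim3 q)"

lemma qcnj_sel [simp]:
  "qre (qcnj q) = qre q" "qim1 (qcnj q) = - qim1 q"
  "qim2 (qcnj q) = - qim2 q" "qim3 (qcnj q) = - qim3 q"
  by (simp_all add: qcnj_def)

lemma quat_norm_sq: "(norm q)\<^sup>2 = (qre q)\<^sup>2 + (qim1 q)\<^sup>2 + (qim2 q)\<^sup>2 + (qim3 q)\<^sup>2"
  for q :: quat
  by (simp add: norm_quat_def inner_quat_def power2_eq_square)

lemma quat_mult_cnj: "q * qcnj q = of_real ((norm q)\<^sup>2)" "qcnj q * q = of_real ((norm q)\<^sup>2)"
  unfolding quat_norm_sq by (simp_all add: quat_eq_iff of_real_def power2_eq_square)

instantiation quat :: real_normed_div_algebra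
begin

definition inverse_quat :: "quat \<Rightarrow> quat" where
  "inverse q = scaleR (inverse ((norm q)\<^sup>2)) (qcnj q)"

definition divide_quat :: "quat \<Rightarrow> quat \<Rightarrow> quat" where
  "p div q = p * inverse q" for p q :: quat

instance
proof
  fix p q :: quat
  show "inverse p * p = 1" if "p \<noteq> 0"
    using that by (simp add: inverse_quat_def quat_mult_cnj of_real_def)
  show "p * inverse p = 1" if "p \<noteq> 0"
    using that by (simp add: inverse_quat_def quat_mult_cnj of_real_def)
  show "p div q = p * inverse q" by (simp add: divide_quat_def)
  show "inverse (0 :: quat) = 0" by (simp add: inverse_quat_def)
  have "(norm (p * q))\<^sup>2 = (norm p * norm q)\<^sup>2"
    unfolding power_mult_distrib quat_norm_sq quat_mult_sel by algebra
  then show "norm (p * q) = norm p * norm q"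
    by (simp add: power2_eq_iff_nonneg)
qed

end

definition quat_i :: quat where
  "quat_i = Quat 0 1 0 0"

text \<open>The subfield \<open>\<real> + \<real> i\<close> of the quaternions.\<close>

definition complex_plane :: "quat set" where
  "complex_plane = {of_real \<alpha> + of_real \<beta> * quat_i | \<alpha> \<beta>. True}"

definition imag_units :: "quat set" where
  "imag_units = {m. m\<^sup>2 = - 1}"

definition circularization :: "quat set \<Rightarrow> quat set" where
  "circularization X =
     {of_real \<alpha> + of_real \<beta> * m | \<alpha> \<beta> m. of_real \<alpha> + of_real \<beta> * quat_i \<in> X \<and> m \<in> imag_units}"

text \<open>The centre may be any quaternion, so that a disc is available for every point of
  an \<open>S\<close>-spectrum; for a centre in the complex plane this is the usual closed disc.\<close>

definition complex_disc :: "quat \<Rightarrow> real \<Rightarrow> quat set" where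
  "complex_disc c r = {z \<in> complex_plane. norm (z - c) \<le> r}"


section \<open>Right quaternionic Hilbert spaces\<close>

class quat_right_module = ab_group_add +
  fixes scaleQ :: "'a \<Rightarrow> quat \<Rightarrow> 'a"  (infixl \<open>*\<^sub>Q\<close> 75)
  assumes scaleQ_add_left: "(x + y) *\<^sub>Q q = x *\<^sub>Q q + y *\<^sub>Q q"
    and scaleQ_add_right: "x *\<^sub>Q (p + q) = x *\<^sub>Q p + x *\<^sub>Q q"
    and scaleQ_scaleQ: "x *\<^sub>Q p *\<^sub>Q q = x *\<^sub>Q (p * q)"
    and scaleQ_one: "x *\<^sub>Q 1 = x"

text \<open>The real vector space structure and the norm inherited from \<^class>\<open>real_normed_vector\<close>
  are tied to the quaternionic data by \<open>scaleR_eq_scaleQ\<close> and \<open>norm_eq_sqrt_qinner\<close>.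
  Conjugate symmetry makes \<open>qinner x x\<close> real, so positivity is stated for its real part.\<close>

class quat_inner_space = quat_right_module + real_normed_vector +
  fixes qinner :: "'a \<Rightarrow> 'a \<Rightarrow> quat"
  assumes scaleR_eq_scaleQ: "r *\<^sub>R x = x *\<^sub>Q of_real r"
    and qinner_add_right: "qinner x (y + z) = qinner x y + qinner x z"
    and qinner_scaleQ_right: "qinner x (y *\<^sub>Q q) = qinner x y * q"
    and qinner_commute: "qinner x y = qcnj (qinner y x)"
    and qinner_ge_zero: "0 \<le> qre (qinner x x)"
    and qinner_eq_zero_iff: "qinner x x = 0 \<longleftrightarrow> x = 0"
    and norm_eq_sqrt_qinner: "norm x = sqrt (qre (qinner x x))"

class quat_hilbert_space = quat_inner_space + complete_space


section \<open>Bounded operators\<close>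

definition bounded_qlinear :: "('h::quat_hilbert_space \<Rightarrow> 'h) \<Rightarrow> bool" where
  "bounded_qlinear T \<longleftrightarrow> bounded_linear T \<and> (\<forall>x q. T (x *\<^sub>Q q) = T x *\<^sub>Q q)"

definition qadjoint :: "('h::quat_hilbert_space \<Rightarrow> 'h) \<Rightarrow> 'h \<Rightarrow> 'h" where
  "qadjoint T = (THE S. bounded_qlinear S \<and> (\<forall>x y. qinner (S x) y = qinner x (T y)))"

definition self_adjoint :: "('h::quat_hilbert_space \<Rightarrow> 'h) \<Rightarrow> bool" where
  "self_adjoint T \<longleftrightarrow> qadjoint T = T"

definition op_invertible :: "('h::quat_hilbert_space \<Rightarrow> 'h) \<Rightarrow> bool" where
  "op_invertible A \<longleftrightarrow> (\<exists>B. bounded_qlinear B \<and> B \<circ> A = id \<and> A \<circ> B = id)"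

definition Qop :: "quat \<Rightarrow> ('h::quat_hilbert_space \<Rightarrow> 'h) \<Rightarrow> 'h \<Rightarrow> 'h" where
  "Qop q T = (\<lambda>x. T (T x) - (2 * qre q) *\<^sub>R T x + (norm q)\<^sup>2 *\<^sub>R x)"

definition S_spectrum :: "('h::quat_hilbert_space \<Rightarrow> 'h) \<Rightarrow> quat set" where
  "S_spectrum T = {q. \<not> op_invertible (Qop q T)}"

text \<open>Outside the \<open>S\<close>-spectrum the inverse in the operator algebra is the inverse function
  \<open>inv (Qop q T)\<close>, and \<^const>\<open>onorm\<close> is the operator norm on bounded operators.\<close>

definition pseudo_S_spectrum :: "real \<Rightarrow> ('h::quat_hilbert_space \<Rightarrow> 'h) \<Rightarrow> quat set" where
  "pseudo_S_spectrum \<epsilon> T =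
     S_spectrum T \<union> {q. q \<notin> S_spectrum T \<and> onorm (inv (Qop q T)) \<ge> 1 / \<epsilon>}"

end

theory Submission
  imports Defs
begin

text \<open>
  Write \<open>q\<close> with real part \<open>a\<close> and imaginary part of modulus \<open>b\<close>, and put \<open>S = T - a\<close>. Then
  \<open>Q\<^sub>q(T) = S\<^sup>2 + b\<^sup>2\<close> is a nonnegative symmetric operator, and for such operators the norm of
  the inverse is the reciprocal of the lower bound of the quadratic form, here \<open>s + b\<^sup>2\<close> for the
  largest \<open>s\<close> with \<open>s \<parallel>x\<parallel>\<^sup>2 \<le> \<parallel>S x\<parallel>\<^sup>2\<close>. The operator \<open>S\<^sup>2 - s = (S - \<surd>s) (S + \<surd>s)\<close> is
  nonnegative with lower bound 0, hence not invertible, so \<open>a + \<surd>s\<close> or \<open>a - \<surd>s\<close> is spectral;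
  conversely \<open>S\<^sup>2 - t\<^sup>2\<close> is coercive for \<open>t\<^sup>2 < s\<close>, so no spectral point is closer to \<open>a\<close> than
  \<open>\<surd>s\<close>. Invertibility of coercive operators and the existence of adjoints, without which the
  definite description defining the adjoint would be meaningless, both come from minimising a
  quadratic functional.
\<close>

section \<open>The real inner product\<close>

text \<open>The real part is enough for the variational arguments; quaternionic identities are
  recovered through \<open>qinner_eq_of_rinner\<close>.\<close>

definition rinner :: "'h::quat_inner_space \<Rightarrow> 'h \<Rightarrow> real" where
  "rinner x y = qre (qinner x y)"

lemma rinner_commute: "rinner x y = rinner y x"
  unfolding rinner_def by (subst qinner_commute) simp

lemma rinner_add_right: "rinner x (y + z) = rinner x y + rinner x z"
  by (simp add: rinner_def qinner_add_right)

lemma rinner_scaleR_right: "rinner x (r *\<^sub>R y) = r * rinner x y"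
  by (simp add: rinner_def scaleR_eq_scaleQ qinner_scaleQ_right of_real_def)

lemma rinner_add_left: "rinner (x + y) z = rinner x z + rinner y z"
  by (metis rinner_add_right rinner_commute)

lemma rinner_scaleR_left: "rinner (r *\<^sub>R x) y = r * rinner x y"
  by (metis rinner_scaleR_right rinner_commute)

lemma rinner_minus_right: "rinner x (- y) = - rinner x y"
  using rinner_scaleR_right[of x "-1" y] by simp

lemma rinner_minus_left: "rinner (- x) y = - rinner x y"
  using rinner_scaleR_left[of "-1" x y] by simp

lemma rinner_diff_right: "rinner x (y - z) = rinner x y - rinner x z"
  using rinner_add_right[of x y "- z"] by (simp add: rinner_minus_right)

lemma rinner_diff_left: "rinner (x - y) z = rinner x z - rinner y z"
  using rinner_add_left[of x "- y" z] by (simp add: rinner_minus_left)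

lemmas rinner_simps = rinner_add_left rinner_add_right rinner_diff_left rinner_diff_right
  rinner_scaleR_left rinner_scaleR_right rinner_minus_left rinner_minus_right

lemma rinner_self: "rinner x x = (norm x)\<^sup>2"
  by (simp add: rinner_def norm_eq_sqrt_qinner qinner_ge_zero)

text \<open>The triangle inequality is a class axiom here, so Cauchy-Schwarz is read off by squaring
  it.\<close>

lemma rinner_le_norm: "rinner x y \<le> norm x * norm y"
proof -
  have "rinner (x + y) (x + y) \<le> (norm x + norm y)\<^sup>2"
    unfolding rinner_self by (simp add: norm_triangle_ineq power_mono)
  then show ?thesis
    using rinner_commute[of x y] rinner_self[of x] rinner_self[of y]
    by (simp add: rinner_add_left rinner_add_right power2_sum)
qed

lemma abs_rinner_le_norm: "\<bar>rinner x y\<bar> \<le> norm x * norm y"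
  using rinner_le_norm[of x y] rinner_le_norm[of "- x" y] by (simp add: rinner_minus_left)

lemma rinner_ext:
  assumes "\<And>y. rinner u y = rinner v y"
  shows "u = v"
proof -
  have "rinner (u - v) (u - v) = 0"
    by (simp add: rinner_diff_left assms)
  then show ?thesis by (simp add: rinner_self)
qed

lemma bounded_bilinear_rinner: "bounded_bilinear rinner"
proof
  show "\<exists>K. \<forall>x y. norm (rinner x y) \<le> norm x * norm y * K"
    by (rule exI[of _ 1]) (simp add: abs_rinner_le_norm)
qed (simp_all add: rinner_simps)

lemmas bounded_linear_rinner = bounded_bilinear.bounded_linear_right[OF bounded_bilinear_rinner]

text \<open>Letting \<open>q\<close> run through 1, i, j, k isolates, up to sign, each component of
  the quaternionic product.\<close>

lemma qinner_eq_of_rinner: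
  assumes "\<And>q. rinner u (y *\<^sub>Q q) = rinner v (w *\<^sub>Q q)"
  shows "qinner u y = qinner v w"
proof -
  have *: "qre (qinner u y * q) = qre (qinner v w * q)" for q
    using assms[of q] by (simp add: rinner_def qinner_scaleQ_right)
  show ?thesis
    using *[of 1] *[of "Quat 0 1 0 0"] *[of "Quat 0 0 1 0"] *[of "Quat 0 0 0 1"]
    by (simp add: quat_eq_iff)
qed

lemma qinner_scaleQ_left: "qinner (x *\<^sub>Q q) y = qcnj q * qinner x y"
proof -
  have "qinner (x *\<^sub>Q q) y = qcnj (qinner y x * q)"
    by (subst qinner_commute) (simp add: qinner_scaleQ_right)
  also have "\<dots> = qcnj q * qcnj (qinner y x)"
    by (simp add: quat_eq_iff algebra_simps)
  finally show ?thesis by (metis qinner_commute)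
qed

lemma scaleR_scaleQ_commute: "(r *\<^sub>R x) *\<^sub>Q q = r *\<^sub>R (x *\<^sub>Q q)"
  for x :: "'h::quat_inner_space"
proof -
  have "of_real r * q = q * of_real r"
    by (simp add: quat_eq_iff of_real_def)
  then show ?thesis by (simp add: scaleR_eq_scaleQ scaleQ_scaleQ)
qed

lemma scaleQ_diff_left: "(x - y) *\<^sub>Q q = x *\<^sub>Q q - y *\<^sub>Q q"
  for x :: "'h::quat_inner_space"
  using scaleQ_add_left[of "x - y" y q] by (simp add: algebra_simps)

section \<open>Symmetric and coercive operators\<close>

definition symmetric_op :: "('h::quat_inner_space \<Rightarrow> 'h) \<Rightarrow> bool" where
  "symmetric_op P \<longleftrightarrow> bounded_linear P \<and> (\<forall>x y. rinner (P x) y = rinner x (P y))"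

lemma symmetric_opD:
  assumes "symmetric_op P"
  shows "P (x + y) = P x + P y" "P (x - y) = P x - P y" "P (r *\<^sub>R x) = r *\<^sub>R P x"
    "rinner (P x) y = rinner (P y) x"
proof -
  interpret P: bounded_linear P
    using assms by (simp add: symmetric_op_def)
  show "P (x + y) = P x + P y" "P (x - y) = P x - P y" "P (r *\<^sub>R x) = r *\<^sub>R P x"
    by (simp_all add: P.add P.diff P.scaleR)
  show "rinner (P x) y = rinner (P y) x"
    using assms by (simp add: symmetric_op_def rinner_commute[of x])
qed

text \<open>First-order condition at a minimum: for small \<open>t\<close> the linear term
  dominates. The choice \<open>t = - l / k\<close> with \<open>k > b\<close> makes the expression
  negative unless \<open>l = 0\<close>.\<close>

lemma quadratic_nonneg_linear_zero:
  fixes l b :: real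
  assumes "\<And>t. 0 \<le> t * l + t\<^sup>2 * b"
  shows "l = 0"
proof (rule ccontr)
  assume "l \<noteq> 0"
  define k where "k = \<bar>b\<bar> + 1"
  have k: "k > 0" "b < k" unfolding k_def by auto
  have "0 \<le> (- l / k) * l + (- l / k)\<^sup>2 * b" by (rule assms)
  also have "\<dots> = l\<^sup>2 * (b - k) / k\<^sup>2"
    using k by (simp add: field_simps power2_eq_square)
  also have "\<dots> < 0"
    using k \<open>l \<noteq> 0\<close> by (simp add: divide_neg_pos mult_pos_neg)
  finally show False by simp
qed

text \<open>The solution minimises \<open>\<langle>P x, x\<rangle> / 2 - f x\<close>; the parallelogram law makes minimising sequences
  Cauchy.\<close>

lemma coercive_representation:
  fixes P :: "'h::quat_hilbert_space \<Rightarrow> 'h"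
  assumes sym: "symmetric_op P" and c: "c > 0"
    and coer: "\<And>x. c * (norm x)\<^sup>2 \<le> rinner (P x) x"
    and f: "bounded_linear f"
  shows "\<exists>z. \<forall>y. rinner (P z) y = f y"
proof -
  interpret f: bounded_linear f by fact
  interpret P: bounded_linear P
    using sym by (simp add: symmetric_op_def)
  obtain K where K: "\<And>x. norm (f x) \<le> norm x * K"
    using f.bounded by blast
  define F where "F x = rinner (P x) x / 2 - f x" for x
  define m where "m = Inf (range F)"
  \<comment> \<open>Completing the square in \<open>norm x\<close> gives the bound.\<close>
  have low: "- K\<^sup>2 / (2 * c) \<le> F x" for x
  proof -
    have "f x \<le> norm x * K" using K[of x] by simp
    moreover have "0 \<le> (c * norm x - K)\<^sup>2 / (2 * c)" using c by simp
    moreover have "(c * norm x - K)\<^sup>2 / (2 * c) = c * (norm x)\<^sup>2 / 2 - norm x * K + K\<^sup>2 / (2 * c)"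
      using c by (simp add: field_simps power2_eq_square)
    ultimately show ?thesis using coer[of x] by (simp add: F_def)
  qed
  have bdd: "bdd_below (range F)" using low by (rule bdd_belowI2)
  have m_le: "m \<le> F x" for x
    unfolding m_def using bdd by (simp add: cINF_lower)
  have "\<exists>x. F x < m + inverse (real (Suc n))" for n
    using cInf_lessD[of "range F" "m + inverse (real (Suc n))"] by (auto simp: m_def)
  then obtain X where X: "\<And>n. F (X n) < m + inverse (real (Suc n))" by metis
  have par: "c / 4 * (norm (x - y))\<^sup>2 \<le> F x + F y - 2 * m" for x y
  proof -
    \<comment> \<open>The linear functional cancels at the midpoint, leaving the parallelogram
      identity for the form of \<open>P\<close>.\<close>
    have "rinner (P (x - y)) (x - y) / 4 = F x + F y - 2 * F ((1/2) *\<^sub>R (x + y))"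
      using symmetric_opD(4)[OF sym, of y x]
      by (simp add: F_def P.add P.diff P.scaleR f.add f.scaleR rinner_simps field_simps
          del: scaleR_half_double)
    then show ?thesis using coer[of "x - y"] m_le[of "(1/2) *\<^sub>R (x + y)"] by simp
  qed
  have "Cauchy X"
  proof (rule metric_CauchyI)
    fix e :: real assume e: "e > 0"
    then have "c / 8 * e\<^sup>2 > 0" using c by simp
    then obtain M where M: "inverse (real (Suc M)) < c / 8 * e\<^sup>2"
      using reals_Archimedean by blast
    have small: "F (X n) < m + c / 8 * e\<^sup>2" if "n \<ge> M" for n
    proof -
      have "inverse (real (Suc n)) \<le> inverse (real (Suc M))"
        using that by (simp add: le_imp_inverse_le)
      then show ?thesis using X[of n] M by linarith
    qed
    show "\<exists>M. \<forall>i\<ge>M. \<forall>j\<ge>M. dist (X i) (X j) < e"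
    proof (intro exI allI impI)
      fix i j assume "i \<ge> M" "j \<ge> M"
      then have "c / 4 * (norm (X i - X j))\<^sup>2 < c / 4 * e\<^sup>2"
        using par[of "X i" "X j"] small[of i] small[of j] by linarith
      then have "(norm (X i - X j))\<^sup>2 < e\<^sup>2" using c by simp
      then show "dist (X i) (X j) < e"
        using e by (simp add: dist_norm power2_less_imp_less)
    qed
  qed
  then obtain z where z: "X \<longlonglongrightarrow> z"
    using Cauchy_convergent_iff convergentD by blast
  have min: "F z \<le> F y" for y
  proof -
    have PX: "(\<lambda>n. rinner (P (X n)) (X n)) \<longlonglongrightarrow> rinner (P z) z"
      by (intro bounded_bilinear.tendsto[OF bounded_bilinear_rinner] P.tendsto z)
    have "(\<lambda>n. F (X n)) \<longlonglongrightarrow> F z"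
      unfolding F_def by (intro tendsto_intros PX f.tendsto z) simp
    moreover note LIMSEQ_inverse_real_of_nat_add[of m]
    ultimately have "F z \<le> m"
      by (rule LIMSEQ_le) (use X less_imp_le in blast)
    then show ?thesis using m_le[of y] by simp
  qed
  have "rinner (P z) y = f y" for y
  proof -
    \<comment> \<open>This is \<open>F (z + t *\<^sub>R y) - F z\<close> expanded in
      \<open>t\<close>; its linear coefficient must vanish.\<close>
    have "0 \<le> t * (rinner (P z) y - f y) + t\<^sup>2 * (rinner (P y) y / 2)" for t
      using min[of "z + t *\<^sub>R y"] symmetric_opD(4)[OF sym, of y z]
      by (simp add: F_def P.add P.scaleR f.add f.scaleR rinner_simps field_simps power2_eq_square)
    then show ?thesis using quadratic_nonneg_linear_zero by fastforce
  qed
  then show ?thesis by blast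
qed

text \<open>Discriminant argument for the form of \<open>P\<close> along
  \<open>x + t *\<^sub>R y\<close>; the form may be degenerate, so a vanishing leading coefficient
  needs its own case.\<close>

lemma symmetric_op_Cauchy_Schwarz:
  assumes sym: "symmetric_op P" and nonneg: "\<And>x. 0 \<le> rinner (P x) x"
  shows "(rinner (P x) y)\<^sup>2 \<le> rinner (P x) x * rinner (P y) y"
proof -
  define b where "b = rinner (P x) y"
  have q: "0 \<le> rinner (P x) x + 2 * t * b + t\<^sup>2 * rinner (P y) y" for t
    using nonneg[of "x + t *\<^sub>R y"] symmetric_opD(4)[OF sym, of y x]
    by (simp add: symmetric_opD(1,3)[OF sym] rinner_simps b_def power2_eq_square algebra_simps)
  show ?thesis
  proof (cases "rinner (P y) y = 0")
    case True
    have "b = 0"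
    proof (rule ccontr)
      assume "b \<noteq> 0"
      \<comment> \<open>Without a quadratic term the form is affine in \<open>t\<close>, and this
        \<open>t\<close> gives it the value -1.\<close>
      then show False
        using q[of "- (rinner (P x) x + 1) / (2 * b)"] True by (simp add: field_simps)
    qed
    then show ?thesis by (simp add: b_def nonneg)
  next
    case False
    then have "rinner (P y) y > 0" using nonneg[of y] by linarith
    then show ?thesis
      using q[of "- b / rinner (P y) y"]
      by (simp add: b_def field_simps power2_eq_square)
  qed
qed

lemma coercive_norm_le:
  assumes "c * (norm x)\<^sup>2 \<le> rinner (P x) x"
  shows "c * norm x \<le> norm (P x)"
proof (cases "x = 0")
  case False
  have "c * norm x * norm x \<le> norm (P x) * norm x"
    using assms rinner_le_norm[of "P x" x] by (simp add: power2_eq_square mult.assoc)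
  then show ?thesis using False by simp
qed simp

section \<open>Invertible operators and the norm of the inverse\<close>

lemma op_invertible_iff_bij:
  "op_invertible A \<longleftrightarrow> bij A \<and> bounded_qlinear (inv A)"
proof
  assume "op_invertible A"
  then obtain B where B: "bounded_qlinear B" "B \<circ> A = id" "A \<circ> B = id"
    by (auto simp: op_invertible_def)
  then have "bij A" using o_bij by blast
  moreover have "inv A = B" using B(3,2) by (rule inv_unique_comp)
  ultimately show "bij A \<and> bounded_qlinear (inv A)" using B by simp
next
  assume A: "bij A \<and> bounded_qlinear (inv A)"
  then have "inv A \<circ> A = id" "A \<circ> inv A = id"
    by (simp_all add: bij_def inj_iff surj_iff)
  then show "op_invertible A"
    using A unfolding op_invertible_def by blast
qed

lemma bounded_qlinear_compose:
  assumes "bounded_qlinear A" "bounded_qlinear B"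
  shows "bounded_qlinear (A \<circ> B)"
  using assms unfolding bounded_qlinear_def
  by (auto simp: o_def intro: bounded_linear_compose)

text \<open>Lax-Milgram: coercivity gives injectivity and bounds the inverse by
  \<open>1 / c\<close>, while representing the functional \<open>rinner y\<close> gives a preimage
  of \<open>y\<close>.\<close>

lemma op_invertible_coercive:
  assumes sym: "symmetric_op P" and q: "bounded_qlinear P" and c: "c > 0"
    and coer: "\<And>x. c * (norm x)\<^sup>2 \<le> rinner (P x) x"
  shows "op_invertible P"
proof -
  have lower: "c * norm x \<le> norm (P x)" for x
    using coer by (rule coercive_norm_le)
  have Pq: "P (x *\<^sub>Q r) = P x *\<^sub>Q r" for x r
    using q by (simp add: bounded_qlinear_def)
  have "inj P"
  proof (rule injI)
    fix x y assume "P x = P y"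
    then have "c * norm (x - y) \<le> 0"
      using lower[of "x - y"] by (simp add: symmetric_opD(2)[OF sym])
    then show "x = y" using c by (simp add: mult_le_0_iff)
  qed
  moreover have "\<exists>z. P z = y" for y
    using coercive_representation[OF sym c coer bounded_linear_rinner[of y]] rinner_ext by blast
  then have surj: "surj P" by (metis surjI)
  ultimately have bij: "bij P" by (simp add: bij_def)
  have eqI: "x = y" if "P x = P y" for x y
    using that \<open>inj P\<close> by (simp add: inj_eq)
  have P_inv: "P (inv P y) = y" for y
    using surj by (simp add: surj_f_inv_f)
  have "bounded_linear (inv P)"
  proof (rule bounded_linear_intro[where K = "1 / c"])
    show "inv P (x + y) = inv P x + inv P y" for x y
      by (rule eqI) (simp add: symmetric_opD(1)[OF sym] P_inv)
    show "inv P (r *\<^sub>R x) = r *\<^sub>R inv P x" for r x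
      by (rule eqI) (simp add: symmetric_opD(3)[OF sym] P_inv)
    show "norm (inv P x) \<le> norm x * (1 / c)" for x
      using lower[of "inv P x"] c by (simp add: P_inv field_simps)
  qed
  moreover have "inv P (x *\<^sub>Q r) = inv P x *\<^sub>Q r" for x r
    by (rule eqI) (simp add: Pq P_inv)
  ultimately show ?thesis
    using bij by (simp add: op_invertible_iff_bij bounded_qlinear_def)
qed

lemma onorm_inv_le:
  assumes inv: "op_invertible P" and c: "c > 0"
    and coer: "\<And>x. c * (norm x)\<^sup>2 \<le> rinner (P x) x"
  shows "onorm (inv P) \<le> 1 / c"
proof (rule onorm_bound)
  fix y
  have "P (inv P y) = y"
    using inv by (simp add: op_invertible_iff_bij bij_is_surj surj_f_inv_f)
  then show "norm (inv P y) \<le> 1 / c * norm y"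
    using coercive_norm_le[where P = P and x = "inv P y", OF coer] c by (simp add: field_simps)
qed (use c in simp)

text \<open>Converse to \<open>onorm_inv_le\<close> for nonnegative \<open>P\<close>. Cauchy-Schwarz
  for the form of \<open>P\<close> at \<open>x\<close> and \<open>y = inv P x\<close> bounds
  \<open>(norm x)^4\<close> by the form at \<open>x\<close> times \<open>rinner x y\<close>, and the
  latter is at most \<open>onorm (inv P) * (norm x)^2\<close>.\<close>

lemma norm_le_onorm_inv:
  assumes sym: "symmetric_op P" and nonneg: "\<And>x. 0 \<le> rinner (P x) x"
    and inv: "op_invertible P"
  shows "(norm x)\<^sup>2 \<le> onorm (inv P) * rinner (P x) x"
proof (cases "x = 0")
  case True
  then show ?thesis using symmetric_opD(3)[OF sym, of 0 0] rinner_scaleR_left[of 0 0 x] by simp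
next
  case False
  define y where "y = inv P x"
  have Py: "P y = x"
    using inv by (simp add: y_def op_invertible_iff_bij bij_is_surj surj_f_inv_f)
  have "norm y \<le> onorm (inv P) * norm x"
    unfolding y_def using inv by (intro onorm) (simp add: op_invertible_iff_bij bounded_qlinear_def)
  then have "rinner (P y) y \<le> norm x * (onorm (inv P) * norm x)"
    unfolding Py by (metis rinner_le_norm mult_left_mono norm_ge_zero order_trans)
  then have "rinner (P x) x * rinner (P y) y \<le> rinner (P x) x * (norm x * (onorm (inv P) * norm x))"
    by (rule mult_left_mono) (rule nonneg)
  moreover have "(rinner (P x) y)\<^sup>2 = (norm x)\<^sup>2 * (norm x)\<^sup>2"
    using symmetric_opD(4)[OF sym, of x y] by (simp add: Py rinner_self power2_eq_square)
  ultimately have "(norm x)\<^sup>2 * (norm x)\<^sup>2 \<le> (norm x)\<^sup>2 * (onorm (inv P) * rinner (P x) x)"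
    using symmetric_op_Cauchy_Schwarz[OF sym nonneg, of x y]
    by (simp add: power2_eq_square mult_ac)
  then show ?thesis
    by (rule mult_left_le_imp_le) (use False in simp)
qed

text \<open>An inverse \<open>C\<close> of the product yields the right inverse
  \<open>B \<circ> C\<close> and, by commutation, the left inverse \<open>C \<circ> B\<close>; the
  two agree.\<close>

lemma op_invertible_factor:
  assumes A: "bounded_qlinear A" and B: "bounded_qlinear B"
    and comm: "A \<circ> B = B \<circ> A" and inv: "op_invertible (A \<circ> B)"
  shows "op_invertible A"
proof -
  obtain C where C: "bounded_qlinear C" "C \<circ> (A \<circ> B) = id" "(A \<circ> B) \<circ> C = id"
    using inv by (auto simp: op_invertible_def)
  have r: "A \<circ> (B \<circ> C) = id" using C(3) by (simp add: comp_assoc)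
  have l: "(C \<circ> B) \<circ> A = id" using C(2) comm by (simp add: comp_assoc)
  have "C \<circ> B = B \<circ> C"
    by (metis l r comp_assoc comp_id id_comp)
  then show ?thesis
    unfolding op_invertible_def using l r bounded_qlinear_compose[OF B C(1)] by metis
qed

lemma op_invertible_comp:
  assumes "op_invertible A" "op_invertible B"
  shows "op_invertible (A \<circ> B)"
  using assms unfolding op_invertible_iff_bij
  by (simp add: bij_comp o_inv_distrib bounded_qlinear_compose)

section \<open>Adjoints\<close>

lemma symmetric_op_id: "symmetric_op (\<lambda>x. x)"
  by (simp add: symmetric_op_def bounded_linear_ident)

lemma qinner_ext:
  assumes "\<And>y. qinner u y = qinner v y"
  shows "u = v"
  by (rule rinner_ext) (simp add: rinner_def assms)

text \<open>Riesz representation, which is \<open>coercive_representation\<close> for the identity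
  with \<open>c = 1\<close>, gives a real adjoint; right linearity of \<open>T\<close> upgrades it
  to a quaternionic one.\<close>

lemma ex_qadjoint:
  fixes T :: "'h::quat_hilbert_space \<Rightarrow> 'h"
  assumes T: "bounded_qlinear T"
  shows "\<exists>S. bounded_qlinear S \<and> (\<forall>x y. qinner (S x) y = qinner x (T y))"
proof -
  have T': "bounded_linear T" and Tq: "\<And>x q. T (x *\<^sub>Q q) = T x *\<^sub>Q q"
    using T by (auto simp: bounded_qlinear_def)
  have "\<exists>z. \<forall>y. rinner z y = rinner x (T y)" for x
    using coercive_representation[OF symmetric_op_id zero_less_one,
        where f = "\<lambda>y. rinner x (T y)"]
      bounded_linear_compose[OF bounded_linear_rinner T'] by (simp add: rinner_self)
  then obtain S where S: "\<And>x y. rinner (S x) y = rinner x (T y)" by metis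
  have adj: "qinner (S x) y = qinner x (T y)" for x y
    by (rule qinner_eq_of_rinner) (simp add: S flip: Tq)
  obtain K where K: "\<And>x. norm (T x) \<le> norm x * K"
    using bounded_linear.bounded[OF T'] by blast
  have "bounded_linear S"
  proof (rule bounded_linear_intro[where K = K])
    show "S (x + y) = S x + S y" for x y
      by (rule rinner_ext) (simp add: S rinner_simps)
    show "S (r *\<^sub>R x) = r *\<^sub>R S x" for r x
      by (rule rinner_ext) (simp add: S rinner_simps)
    show "norm (S x) \<le> norm x * K" for x
    proof (cases "S x = 0")
      case True
      \<comment> \<open>The sign of \<open>K\<close> is not known; the bound at \<open>x\<close>
        itself yields \<open>0 \<le> norm x * K\<close>.\<close>
      then show ?thesis using order_trans[OF norm_ge_zero K[of x]] by simp
    next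
      case False
      have "norm (S x) * norm (S x) = rinner x (T (S x))"
        by (simp flip: S add: rinner_self power2_eq_square)
      also have "\<dots> \<le> norm x * (norm (S x) * K)"
        by (metis rinner_le_norm K mult_left_mono norm_ge_zero order_trans)
      finally show ?thesis using False by (simp add: mult.left_commute)
    qed
  qed
  moreover have "S (x *\<^sub>Q q) = S x *\<^sub>Q q" for x q
    by (rule qinner_ext) (simp add: adj qinner_scaleQ_left)
  ultimately show ?thesis using adj by (auto simp: bounded_qlinear_def)
qed

text \<open>Existence from \<open>ex_qadjoint\<close> together with uniqueness makes the description
  in \<open>qadjoint\<close> denote an actual adjoint.\<close>

lemma self_adjoint_symmetric:
  assumes T: "bounded_qlinear T" and "self_adjoint T"
  shows "symmetric_op T"
proof -
  obtain S where S: "bounded_qlinear S \<and> (\<forall>x y. qinner (S x) y = qinner x (T y))"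
    using ex_qadjoint[OF T] by blast
  have "qadjoint T = S"
    unfolding qadjoint_def
  proof (rule the_equality)
    fix R assume "bounded_qlinear R \<and> (\<forall>x y. qinner (R x) y = qinner x (T y))"
    then show "R = S" using S by (intro ext qinner_ext) simp
  qed (rule S)
  then have "S = T" using assms(2) by (simp add: self_adjoint_def)
  then show ?thesis
    using S by (simp add: symmetric_op_def rinner_def bounded_qlinear_def)
qed

section \<open>The operators \<open>Q\<^sub>q(T)\<close>\<close>

definition shift :: "('h::quat_hilbert_space \<Rightarrow> 'h) \<Rightarrow> real \<Rightarrow> 'h \<Rightarrow> 'h" where
  "shift T r = (\<lambda>x. T x - r *\<^sub>R x)"

lemma bounded_qlinear_shift:
  assumes "bounded_qlinear T"
  shows "bounded_qlinear (shift T r)"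
  using assms unfolding bounded_qlinear_def shift_def
  by (auto intro!: bounded_linear_sub bounded_linear_scaleR_right bounded_linear_ident
      simp: scaleQ_diff_left scaleR_scaleQ_commute)

lemma symmetric_op_shift:
  assumes "symmetric_op T"
  shows "symmetric_op (shift T r)"
  using assms unfolding symmetric_op_def shift_def
  by (auto intro!: bounded_linear_sub bounded_linear_scaleR_right bounded_linear_ident
      simp: rinner_simps)

lemma symmetric_op_square:
  assumes "symmetric_op S"
  shows "symmetric_op (S \<circ> S)" "rinner ((S \<circ> S) x) x = (norm (S x))\<^sup>2"
  using assms by (auto simp: symmetric_op_def o_def bounded_linear_compose simp flip: rinner_self)

lemma shift_form:
  assumes "symmetric_op S"
  shows "rinner (shift (S \<circ> S) r x) x = (norm (S x))\<^sup>2 - r * (norm x)\<^sup>2"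
  using symmetric_op_square(2)[OF assms, of x] by (simp add: shift_def rinner_simps rinner_self)

text \<open>Difference of squares: with \<open>S = T - a\<close> the factors are
  \<open>S - d\<close> and \<open>S + d\<close>.\<close>

lemma shift_square_factor:
  assumes "bounded_qlinear T"
  shows "shift T (a + d) \<circ> shift T (a - d) = shift (shift T a \<circ> shift T a) (d\<^sup>2)"
proof -
  interpret bounded_linear T using assms by (simp add: bounded_qlinear_def)
  show ?thesis
    by (simp add: fun_eq_iff shift_def add diff scaleR algebra_simps power2_eq_square)
qed

definition im_sq :: "quat \<Rightarrow> real" where
  "im_sq q = (qim1 q)\<^sup>2 + (qim2 q)\<^sup>2 + (qim3 q)\<^sup>2"

lemma im_sq_nonneg: "0 \<le> im_sq q"
  by (simp add: im_sq_def)

lemma im_sq_eq_0_iff: "im_sq q = 0 \<longleftrightarrow> q = of_real (qre q)"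
  by (auto simp: im_sq_def quat_eq_iff of_real_def add_nonneg_eq_0_iff)

lemma im_sq_of_real [simp]: "im_sq (of_real r) = 0" and qre_of_real [simp]: "qre (of_real r) = r"
  by (simp_all add: im_sq_def of_real_def)

text \<open>Completing the square, as \<open>(norm q)^2 - (qre q)^2 = im_sq q\<close>;
  \<open>shift\<close> subtracts, hence the minus sign.\<close>

lemma Qop_eq_shift:
  assumes "bounded_qlinear T"
  shows "Qop q T = shift (shift T (qre q) \<circ> shift T (qre q)) (- im_sq q)"
proof -
  interpret bounded_linear T using assms by (simp add: bounded_qlinear_def)
  show ?thesis
    unfolding Qop_def quat_norm_sq
    by (simp add: fun_eq_iff shift_def im_sq_def diff scaleR algebra_simps power2_eq_square
        flip: scaleR_2)
qed

text \<open>At a real point \<open>Qop\<close> is the square of \<open>T - r\<close>, and a square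
  is invertible exactly when its base is.\<close>

lemma in_S_spectrum_of_real_iff:
  assumes "bounded_qlinear T"
  shows "of_real r \<in> S_spectrum T \<longleftrightarrow> \<not> op_invertible (shift T r)"
proof -
  have "Qop (of_real r) T = shift T r \<circ> shift T r"
    unfolding Qop_eq_shift[OF assms] by (simp add: shift_def[of _ 0] o_def)
  then show ?thesis
    using op_invertible_comp[of "shift T r" "shift T r"]
      op_invertible_factor[of "shift T r" "shift T r"] bounded_qlinear_shift[OF assms]
    by (auto simp: S_spectrum_def)
qed

section \<open>Circularized discs\<close>

lemma imag_units_iff: "m \<in> imag_units \<longleftrightarrow> qre m = 0 \<and> im_sq m = 1"
proof -
  have "m\<^sup>2 = - 1 \<longleftrightarrow> (qre m)\<^sup>2 - im_sq m = - 1 \<and>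
      qre m * qim1 m = 0 \<and> qre m * qim2 m = 0 \<and> qre m * qim3 m = 0"
    by (auto simp: quat_eq_iff power2_eq_square im_sq_def)
  also have "\<dots> \<longleftrightarrow> qre m = 0 \<and> im_sq m = 1"
    \<comment> \<open>If \<open>qre m\<close> is nonzero the imaginary part vanishes, and
      \<open>(qre m)^2 = - 1\<close> is impossible.\<close>
    by (cases "qre m = 0")
      (auto simp: im_sq_def, smt (verit) zero_le_power2)
  finally show ?thesis by (simp add: imag_units_def)
qed

lemma in_complex_disc_of_real_iff:
  assumes "r \<ge> 0"
  shows "of_real \<alpha> + of_real \<beta> * quat_i \<in> complex_disc (of_real l) r \<longleftrightarrow> (\<alpha> - l)\<^sup>2 + \<beta>\<^sup>2 \<le> r\<^sup>2"
proof -
  let ?z = "of_real \<alpha> + of_real \<beta> * quat_i"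
  have "(norm (?z - of_real l))\<^sup>2 = (\<alpha> - l)\<^sup>2 + \<beta>\<^sup>2"
    by (simp add: quat_norm_sq of_real_def quat_i_def)
  moreover have "norm (?z - of_real l) \<le> r \<longleftrightarrow> (norm (?z - of_real l))\<^sup>2 \<le> r\<^sup>2"
    using assms by simp
  ultimately show ?thesis by (auto simp: complex_disc_def complex_plane_def)
qed

text \<open>Circularization keeps the real part and the modulus of the imaginary part, and
  membership in a disc with real centre depends on nothing else.\<close>

lemma in_circularization_disc_iff:
  assumes "r \<ge> 0"
  shows "q \<in> circularization (complex_disc (of_real l) r) \<longleftrightarrow> (qre q - l)\<^sup>2 + im_sq q \<le> r\<^sup>2"
proof
  assume "q \<in> circularization (complex_disc (of_real l) r)"
  then obtain \<alpha> \<beta> m where q: "q = of_real \<alpha> + of_real \<beta> * m"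
    and le: "(\<alpha> - l)\<^sup>2 + \<beta>\<^sup>2 \<le> r\<^sup>2" and m: "qre m = 0" "im_sq m = 1"
    using in_complex_disc_of_real_iff[OF assms] by (auto simp: circularization_def imag_units_iff)
  have "im_sq q = \<beta>\<^sup>2 * im_sq m"
    by (simp add: q im_sq_def of_real_def power_mult_distrib algebra_simps)
  moreover have "qre q = \<alpha>" by (simp add: q m of_real_def)
  ultimately show "(qre q - l)\<^sup>2 + im_sq q \<le> r\<^sup>2" using le m by simp
next
  assume le: "(qre q - l)\<^sup>2 + im_sq q \<le> r\<^sup>2"
  define \<beta> where "\<beta> = sqrt (im_sq q)"
  have \<beta>: "\<beta>\<^sup>2 = im_sq q" by (simp add: \<beta>_def im_sq_nonneg)
  have "\<exists>m. m \<in> imag_units \<and> q = of_real (qre q) + of_real \<beta> * m"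
  proof (cases "\<beta> = 0")
    \<comment> \<open>A real \<open>q\<close> has no imaginary direction, so any unit serves;
      \<open>quat_i\<close> is taken.\<close>
    case True
    then have "q = of_real (qre q)" using \<beta> by (simp flip: im_sq_eq_0_iff)
    moreover have "quat_i \<in> imag_units" by (simp add: imag_units_iff quat_i_def im_sq_def)
    ultimately show ?thesis using True by auto
  next
    case False
    define m where "m = inverse \<beta> *\<^sub>R (q - of_real (qre q))"
    have "im_sq m = (inverse \<beta>)\<^sup>2 * im_sq q"
      by (simp add: m_def im_sq_def of_real_def power_mult_distrib algebra_simps)
    then have "m \<in> imag_units"
      using False by (simp add: imag_units_iff m_def of_real_def flip: \<beta> power_mult_distrib)
    moreover have "q = of_real (qre q) + of_real \<beta> * m"
      using False by (simp add: m_def flip: scaleR_conv_of_real)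
    ultimately show ?thesis by blast
  qed
  moreover have "of_real (qre q) + of_real \<beta> * quat_i \<in> complex_disc (of_real l) r"
    using le \<beta> in_complex_disc_of_real_iff[OF assms] by simp
  ultimately show "q \<in> circularization (complex_disc (of_real l) r)"
    unfolding circularization_def by blast
qed

section \<open>The pseudospectrum of a self-adjoint operator\<close>

context
  fixes T :: "'h::quat_hilbert_space \<Rightarrow> 'h"
  assumes T: "bounded_qlinear T" and sym: "symmetric_op T"
begin

lemma symmetric_op_shift_square: "symmetric_op (shift (shift T a \<circ> shift T a) s)"
  by (intro symmetric_op_shift symmetric_op_square sym)

lemma symmetric_op_Qop: "symmetric_op (Qop q T)"
  unfolding Qop_eq_shift[OF T] by (rule symmetric_op_shift_square)

lemma bounded_qlinear_shift_square: "bounded_qlinear (shift (shift T a \<circ> shift T a) s)"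
  by (intro bounded_qlinear_shift bounded_qlinear_compose T)

lemma bounded_qlinear_Qop: "bounded_qlinear (Qop q T)"
  unfolding Qop_eq_shift[OF T] by (rule bounded_qlinear_shift_square)

lemma Qop_form: "rinner (Qop q T x) x = (norm (shift T (qre q) x))\<^sup>2 + im_sq q * (norm x)\<^sup>2"
  unfolding Qop_eq_shift[OF T] by (simp add: shift_form symmetric_op_shift sym)

lemma Qop_form_nonneg: "0 \<le> rinner (Qop q T x) x"
  by (simp add: Qop_form im_sq_nonneg)

text \<open>For nonreal \<open>q\<close> the form of \<open>Qop q T\<close> is coercive with
  constant \<open>im_sq q\<close>.\<close>

lemma S_spectrum_subset_Reals: "S_spectrum T \<subseteq> \<real>"
proof
  fix q assume q: "q \<in> S_spectrum T"
  have "im_sq q = 0"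
  proof (rule ccontr)
    assume "im_sq q \<noteq> 0"
    then have "0 < im_sq q" using im_sq_nonneg[of q] by linarith
    then have "op_invertible (Qop q T)"
      by (intro op_invertible_coercive[where c = "im_sq q"] symmetric_op_Qop bounded_qlinear_Qop)
        (simp_all add: Qop_form)
    then show False using q by (simp add: S_spectrum_def)
  qed
  then show "q \<in> \<real>" by (metis im_sq_eq_0_iff Reals_of_real)
qed

text \<open>If \<open>(a - l)^2 < k\<close>, then \<open>(T - a)^2 - (l - a)^2\<close> is coercive,
  hence invertible, and so is its factor \<open>T - l\<close>.\<close>

lemma lower_bound_spectrum_distance:
  assumes k: "\<And>x. k * (norm x)\<^sup>2 \<le> (norm (shift T a x))\<^sup>2" and l: "of_real l \<in> S_spectrum T"
  shows "k \<le> (a - l)\<^sup>2"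
proof (rule ccontr)
  assume "\<not> k \<le> (a - l)\<^sup>2"
  then have "op_invertible (shift (shift T a \<circ> shift T a) ((l - a)\<^sup>2))"
    using k op_invertible_coercive[OF symmetric_op_shift_square bounded_qlinear_shift_square,
        of "k - (a - l)\<^sup>2"]
    by (simp add: shift_form symmetric_op_shift sym algebra_simps power2_commute[of l a])
  then have "op_invertible (shift T (a + (l - a)) \<circ> shift T (a - (l - a)))"
    by (simp only: shift_square_factor[OF T])
  \<comment> \<open>Replacing \<open>d\<close> by \<open>- d\<close> in the factorisation swaps the
    factors and keeps the square.\<close>
  moreover have "shift T (a + (l - a)) \<circ> shift T (a - (l - a)) =
      shift T (a - (l - a)) \<circ> shift T (a + (l - a))"
    using shift_square_factor[OF T, of a "l - a"] shift_square_factor[OF T, of a "a - l"]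
    by (simp add: power2_commute)
  ultimately have "op_invertible (shift T (a + (l - a)))"
    using op_invertible_factor[OF bounded_qlinear_shift[OF T] bounded_qlinear_shift[OF T]] by blast
  then show False using l by (simp add: in_S_spectrum_of_real_iff[OF T])
qed

text \<open>Invertibility of \<open>?P\<close> would improve the optimal bound \<open>s\<close> by
  \<open>1 / N\<close>; so one of its factors, taken at \<open>d = sqrt s\<close>, is not
  invertible.\<close>

lemma ex_spectrum_point:
  assumes le: "\<And>x. s * (norm x)\<^sup>2 \<le> (norm (shift T a x))\<^sup>2" and s: "0 \<le> s"
    and max: "\<And>k. (\<And>x. k * (norm x)\<^sup>2 \<le> (norm (shift T a x))\<^sup>2) \<Longrightarrow> k \<le> s"
  shows "\<exists>l. of_real l \<in> S_spectrum T \<and> (a - l)\<^sup>2 = s"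
proof -
  let ?P = "shift (shift T a \<circ> shift T a) s"
  have form: "rinner (?P x) x = (norm (shift T a x))\<^sup>2 - s * (norm x)\<^sup>2" for x
    by (simp add: shift_form symmetric_op_shift sym)
  have "\<not> op_invertible ?P"
  proof
    assume inv: "op_invertible ?P"
    \<comment> \<open>The maximum with 1 keeps \<open>N\<close> positive, so that
      \<open>1 / N\<close> is a genuine gain.\<close>
    define N where "N = max 1 (onorm (inv ?P))"
    have "(s + 1 / N) * (norm x)\<^sup>2 \<le> (norm (shift T a x))\<^sup>2" for x
    proof -
      have nn: "0 \<le> rinner (?P x) x" using le[of x] by (simp add: form)
      have "(norm x)\<^sup>2 \<le> onorm (inv ?P) * rinner (?P x) x"
        using le by (intro norm_le_onorm_inv symmetric_op_shift_square inv) (simp add: form)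
      also have "\<dots> \<le> N * rinner (?P x) x"
        using nn by (intro mult_right_mono) (simp_all add: N_def)
      finally show ?thesis
        unfolding form by (simp add: N_def field_simps)
    qed
    then have "s + 1 / N \<le> s" by (rule max)
    then show False by (simp add: N_def field_simps split: if_splits)
  qed
  moreover have "?P = shift T (a + sqrt s) \<circ> shift T (a - sqrt s)"
    using s by (simp add: shift_square_factor[OF T])
  ultimately have "\<not> op_invertible (shift T (a + sqrt s)) \<or> \<not> op_invertible (shift T (a - sqrt s))"
    using op_invertible_comp by metis
  then have "of_real (a + sqrt s) \<in> S_spectrum T \<or> of_real (a - sqrt s) \<in> S_spectrum T"
    by (simp only: in_S_spectrum_of_real_iff[OF T])
  moreover have "(a - (a + sqrt s))\<^sup>2 = s" "(a - (a - sqrt s))\<^sup>2 = s" using s by simp_all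
  ultimately show ?thesis by blast
qed

text \<open>Forward, a spectral point at squared distance \<open>Sup D\<close> from
  \<open>qre q\<close> is found; backward, a norm below \<open>1 / \<epsilon>\<close> would give a
  lower bound that keeps every spectral point too far away.\<close>

lemma onorm_inv_Qop_ge_iff:
  assumes \<epsilon>: "\<epsilon> > 0" and q: "q \<notin> S_spectrum T"
  shows "onorm (inv (Qop q T)) \<ge> 1 / \<epsilon> \<longleftrightarrow>
    (\<exists>l. of_real l \<in> S_spectrum T \<and> (qre q - l)\<^sup>2 + im_sq q \<le> \<epsilon>)"
proof
  have inv: "op_invertible (Qop q T)" using q by (simp add: S_spectrum_def)
  let ?a = "qre q" and ?N = "onorm (inv (Qop q T))"
  {
    assume N: "?N \<ge> 1 / \<epsilon>"
    define D where "D = {k. \<forall>x. k * (norm x)\<^sup>2 \<le> (norm (shift T ?a x))\<^sup>2}"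
    have D_le: "k + im_sq q \<le> \<epsilon>" if "k \<in> D" for k
    proof (rule ccontr)
      assume "\<not> k + im_sq q \<le> \<epsilon>"
      then have gt: "\<epsilon> < k + im_sq q" by simp
      have "?N \<le> 1 / (k + im_sq q)"
      proof (rule onorm_inv_le[OF inv])
        show "(k + im_sq q) * (norm x)\<^sup>2 \<le> rinner (Qop q T x) x" for x
          using that by (simp add: D_def Qop_form distrib_right)
      qed (use gt \<epsilon> in linarith)
      also have "\<dots> < 1 / \<epsilon>" using gt \<epsilon> by (simp add: frac_less2)
      finally show False using N by simp
    qed
    have zero: "0 \<in> D" by (simp add: D_def)
    \<comment> \<open>The assumption on \<open>?N\<close> enters here through \<open>D_le\<close>:
      on the zero space \<open>D\<close> would be all of \<real>.\<close>
    have bdd: "bdd_above D" by (rule bdd_aboveI[of _ "\<epsilon> - im_sq q"]) (use D_le in force)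
    \<comment> \<open>The inequalities defining \<open>D\<close> are closed in \<open>k\<close>, so
      the supremum satisfies them too.\<close>
    have "Sup D \<in> D"
      unfolding D_def
    proof (intro CollectI allI)
      fix x
      show "Sup {k. \<forall>x. k * (norm x)\<^sup>2 \<le> (norm (shift T ?a x))\<^sup>2} * (norm x)\<^sup>2
        \<le> (norm (shift T ?a x))\<^sup>2"
      proof (cases "x = 0")
        case False
        have "Sup D \<le> (norm (shift T ?a x))\<^sup>2 / (norm x)\<^sup>2"
        proof (rule cSup_least)
          show "D \<noteq> {}" using zero by blast
          show "k \<le> (norm (shift T ?a x))\<^sup>2 / (norm x)\<^sup>2" if "k \<in> D" for k
            using that False by (simp add: D_def pos_le_divide_eq)
        qed
        then show ?thesis using False by (simp add: D_def field_simps)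
      qed simp
    qed
    moreover have "k \<le> Sup D" if "k \<in> D" for k using that bdd by (rule cSup_upper)
    ultimately obtain l where "of_real l \<in> S_spectrum T" "(?a - l)\<^sup>2 = Sup D"
      using ex_spectrum_point[of "Sup D" ?a] zero by (auto simp: D_def)
    then show "\<exists>l. of_real l \<in> S_spectrum T \<and> (?a - l)\<^sup>2 + im_sq q \<le> \<epsilon>"
      using D_le[OF \<open>Sup D \<in> D\<close>] by auto
  }
  {
    assume "\<exists>l. of_real l \<in> S_spectrum T \<and> (?a - l)\<^sup>2 + im_sq q \<le> \<epsilon>"
    then obtain l where l: "of_real l \<in> S_spectrum T" "(?a - l)\<^sup>2 + im_sq q \<le> \<epsilon>" by blast
    show "?N \<ge> 1 / \<epsilon>"
    proof (rule ccontr)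
      assume "\<not> ?N \<ge> 1 / \<epsilon>"
      \<comment> \<open>\<open>M\<close> stands in for \<open>?N\<close>, whose positivity is not at
        hand, so that \<open>1 / M\<close> is meaningful.\<close>
      then obtain M where M: "max 0 ?N < M" "M < 1 / \<epsilon>"
        using \<epsilon> dense[of "max 0 ?N" "1 / \<epsilon>"] by auto
      then have "M > 0" by simp
      have "(1 / M - im_sq q) * (norm x)\<^sup>2 \<le> (norm (shift T ?a x))\<^sup>2" for x
      proof -
        have "(norm x)\<^sup>2 \<le> ?N * rinner (Qop q T x) x"
          by (rule norm_le_onorm_inv[OF symmetric_op_Qop Qop_form_nonneg inv])
        also have "\<dots> \<le> M * rinner (Qop q T x) x"
          using M by (intro mult_right_mono Qop_form_nonneg) simp
        finally show ?thesis using \<open>M > 0\<close> by (simp add: Qop_form field_simps)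
      qed
      then have "1 / M - im_sq q \<le> (?a - l)\<^sup>2"
        by (rule lower_bound_spectrum_distance[OF _ l(1)])
      moreover have "\<epsilon> < 1 / M" using M \<epsilon> \<open>M > 0\<close> by (simp add: field_simps)
      ultimately show False using l(2) by linarith
    qed
  }
qed

end

theorem theorem4p10:
  fixes T :: "'h::quat_hilbert_space \<Rightarrow> 'h" and \<epsilon> :: real
  assumes "bounded_qlinear T"
    and "self_adjoint T"
    and "\<epsilon> > 0"
  shows "S_spectrum T \<subseteq> \<real> \<and>
    pseudo_S_spectrum \<epsilon> T = (\<Union>\<mu>\<in>S_spectrum T. circularization (complex_disc \<mu> (sqrt \<epsilon>)))"
proof -
  note sym = self_adjoint_symmetric[OF assms(1,2)]
  have real: "S_spectrum T \<subseteq> \<real>"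
    by (rule S_spectrum_subset_Reals[OF assms(1) sym])
  \<comment> \<open>Both sides of the claim are reduced to this one scalar condition.\<close>
  have "q \<in> pseudo_S_spectrum \<epsilon> T \<longleftrightarrow>
    (\<exists>l. of_real l \<in> S_spectrum T \<and> (qre q - l)\<^sup>2 + im_sq q \<le> \<epsilon>)" for q
  proof (cases "q \<in> S_spectrum T")
    case True
    then obtain l where "q = of_real l" using real by (auto elim: Reals_cases)
    \<comment> \<open>A spectral point is its own witness, at distance 0.\<close>
    then show ?thesis
      using True assms(3) by (auto simp: pseudo_S_spectrum_def intro!: exI[of _ l])
  next
    case False
    then show ?thesis
      using onorm_inv_Qop_ge_iff[OF assms(1) sym assms(3)] by (simp add: pseudo_S_spectrum_def)
  qed
  moreover have "q \<in> (\<Union>\<mu>\<in>S_spectrum T. circularization (complex_disc \<mu> (sqrt \<epsilon>))) \<longleftrightarrow>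
    (\<exists>l. of_real l \<in> S_spectrum T \<and> (qre q - l)\<^sup>2 + im_sq q \<le> \<epsilon>)" for q
  proof -
    have "q \<in> circularization (complex_disc (of_real l) (sqrt \<epsilon>)) \<longleftrightarrow>
        (qre q - l)\<^sup>2 + im_sq q \<le> \<epsilon>" for l
      using assms(3) by (simp add: in_circularization_disc_iff)
    then show ?thesis using real by (fastforce elim: Reals_cases)
  qed
  ultimately show ?thesis using real by blast
qed

end
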